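(* Let $K$ be a field, let $P=K[a_0,a_1,\dots,a_n]$, let $\deg_W$ be the grading on $P$ defined by a positive matrix $W$, and let $\sigma$ be a term ordering on $\mathbb T^{n+1}$ of $a_0$-DegRev type (with respect to $W$). Let $S$ be a finitely generated $W$-graded $K$-subalgebra of $P$, let $a_0\in S$, and let $\mathrm{SB}$ be a $\sigma$-SAGBI basis of $S$. Then the set $$\{a_0\}\cup\{\,g:a_0^\infty\mid g\in\mathrm{SB}\,\}$$ is a $\sigma$-SAGBI basis of $\mathrm{Sat}_{a_0}(S)$.
   Context: $\mathbb T^{n+1}$ is the monoid of power products (terms) in $a_0,\dots,a_n$. A matrix $W\in\mathrm{Mat}_{m,n+1}(\mathbb Z)$ is positive if no column is zero and the first (from the top) non-zero entry of each column is positive; it defines a $\mathbb Z^m$-grading on $P$ in which $\deg_W(a_j)$ is the column of $W$ indexed by $a_j$, $j=0,\dots,n$. A $K$-subalgebra is $W$-graded if it is generated by $W$-homogeneous elements. A term ordering $\sigma$ is compatible with $\deg_W$ if $\deg_W(t)>_{\mathrm{Lex}}\deg_W(t')$ implies $t>_\sigma t'$. It is of $a_0$-DegRev type (with respect to $W$) if it is compatible with $\deg_W$ and, whenever $t,t'\in\mathbb T^{n+1}$ satisfy $\deg_W(t)=\deg_W(t')$ and the exponent of $a_0$ in $t$ is strictly smaller than the exponent of $a_0$ in $t'$, one has $t>_\sigma t'$. $\mathrm{LT}_\sigma(f)$ is the leading term (a power product) of $f\ne0$. A (possibly infinite) set $G$ of non-zero elements of a $K$-subalgebra $A$ of $P$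 is a $\sigma$-SAGBI basis of $A$ if the $K$-algebra generated by $\{\mathrm{LT}_\sigma(f)\mid f\in A\setminus\{0\}\}$ equals the $K$-algebra generated by $\{\mathrm{LT}_\sigma(g)\mid g\in G\}$. For $0\neq f\in P$, $f:a_0^\infty$ is $f/a_0^i$, where $a_0^i$ is the highest power of $a_0$ dividing $f$. The saturation of $S$ with respect to $a_0$ is $\mathrm{Sat}_{a_0}(S)=S[a_0,a_0^{-1}]\cap P$.
   Formalization: The elements of SB are additionally assumed to be W-homogeneous; without this the claim fails, e.g. for S = K[a_0, a_0a_1], W = (1 1), DegRevLex with a_1 > a_0, and SB = {a_0, a_0a_1 + 1}, where a_1 lies in the saturation but is not reached. *)

theory Defs
  imports
    "HOL-Library.Poly_Mapping"
    "HOL-Computational_Algebra.Polynomial_Factorial"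
    "Jordan_Normal_Form.Matrix"
begin

text \<open>
  A power product is identified with its exponent function, so that the product of power products
  is the sum of exponent functions and the power product 1 is the exponent function 0.
  The ring \<open>P = K[a\<^sub>0, \<dots>, a\<^sub>n]\<close> is the subring \<open>polys n\<close> of the polynomial ring in the
  indeterminates \<open>a\<^sub>j\<close>, \<open>j\<close> a natural number.
\<close>

type_synonym pprod = "nat \<Rightarrow>\<^sub>0 nat"
type_synonym 'k mpoly = "(nat \<Rightarrow>\<^sub>0 nat) \<Rightarrow>\<^sub>0 'k"

definition pprods :: "nat \<Rightarrow> pprod set" where
  "pprods n = {t. Poly_Mapping.keys t \<subseteq> {..n}}"

definition polys :: "nat \<Rightarrow> ('k::zero) mpoly set" where
  "polys n = {f. Poly_Mapping.keys f \<subseteq> pprods n}"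

definition scalar :: "'k::field \<Rightarrow> 'k mpoly" where
  "scalar c = Poly_Mapping.single 0 c"

definition pp_poly :: "pprod \<Rightarrow> ('k::field) mpoly" where
  "pp_poly t = Poly_Mapping.single t 1"

definition indet :: "nat \<Rightarrow> ('k::field) mpoly" where
  "indet j = pp_poly (Poly_Mapping.single j 1)"


subsection \<open>Subalgebras\<close>

text \<open>
  The structure of a \<open>K\<close>-algebra on a commutative ring is given by the embedding \<open>\<iota>\<close> of \<open>K\<close>; it is
  \<^const>\<open>scalar\<close> for \<open>P\<close>, and \<open>\<lambda>c. to_fract (scalar c)\<close> for the field of fractions.
\<close>

definition subalgebra_of :: "('k::field \<Rightarrow> 'r::comm_ring_1) \<Rightarrow> 'r set \<Rightarrow> bool" where
  "subalgebra_of \<iota> A \<longleftrightarrow> range \<iota> \<subseteq> A \<and> (\<forall>x\<in>A. \<forall>y\<in>A. x + y \<in> A \<and> x * y \<in> A)"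

definition alg_gen :: "('k::field \<Rightarrow> 'r::comm_ring_1) \<Rightarrow> 'r set \<Rightarrow> 'r set" where
  "alg_gen \<iota> G = subalgebra_of \<iota> hull G"

definition poly_subalgebra :: "nat \<Rightarrow> ('k::field) mpoly set \<Rightarrow> bool" where
  "poly_subalgebra n A \<longleftrightarrow> A \<subseteq> polys n \<and> subalgebra_of scalar A"

definition fin_gen_subalgebra :: "nat \<Rightarrow> ('k::field) mpoly set \<Rightarrow> bool" where
  "fin_gen_subalgebra n A \<longleftrightarrow>
     poly_subalgebra n A \<and> (\<exists>F. finite F \<and> F \<subseteq> polys n \<and> A = alg_gen scalar F)"


subsection \<open>Gradings\<close>

definition positive_matrix :: "int mat \<Rightarrow> bool" where
  "positive_matrix W \<longleftrightarrow>
     (\<forall>j<dim_col W. col W j \<noteq> 0\<^sub>v (dim_row W) \<and>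
        (\<forall>i<dim_row W. W $$ (i, j) \<noteq> 0 \<and> (\<forall>k<i. W $$ (k, j) = 0) \<longrightarrow> W $$ (i, j) > 0))"

definition wdeg :: "int mat \<Rightarrow> pprod \<Rightarrow> int vec" where
  "wdeg W t = W *\<^sub>v vec (dim_col W) (\<lambda>j. int (Poly_Mapping.lookup t j))"

definition lex_less :: "int vec \<Rightarrow> int vec \<Rightarrow> bool" where
  "lex_less v w \<longleftrightarrow> (\<exists>i<dim_vec v. v $ i < w $ i \<and> (\<forall>k<i. v $ k = w $ k))"

definition homogeneous :: "int mat \<Rightarrow> ('k::zero) mpoly \<Rightarrow> bool" where
  "homogeneous W f \<longleftrightarrow>
     (\<forall>s\<in>Poly_Mapping.keys f. \<forall>t\<in>Poly_Mapping.keys f. wdeg W s = wdeg W t)"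

definition graded_subalgebra :: "nat \<Rightarrow> int mat \<Rightarrow> ('k::field) mpoly set \<Rightarrow> bool" where
  "graded_subalgebra n W A \<longleftrightarrow>
     poly_subalgebra n A \<and>
     (\<exists>H. H \<subseteq> polys n \<and> (\<forall>h\<in>H. homogeneous W h) \<and> A = alg_gen scalar H)"


subsection \<open>Term orderings\<close>

text \<open>
  A term ordering is represented by its strict part: \<open>lt s t\<close> means \<open>s <\<^sub>\<sigma> t\<close>.
\<close>

definition term_ordering :: "nat \<Rightarrow> (pprod \<Rightarrow> pprod \<Rightarrow> bool) \<Rightarrow> bool" where
  "term_ordering n lt \<longleftrightarrow>
     irreflp_on (pprods n) lt \<and> transp_on (pprods n) lt \<and> totalp_on (pprods n) lt \<and>
     (\<forall>s\<in>pprods n. \<forall>t\<in>pprods n. \<forall>u\<in>pprods n. lt s t \<longrightarrow> lt (s + u) (t + u)) \<and>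
     (\<forall>t\<in>pprods n. t \<noteq> 0 \<longrightarrow> lt 0 t)"

definition deg_compatible :: "nat \<Rightarrow> int mat \<Rightarrow> (pprod \<Rightarrow> pprod \<Rightarrow> bool) \<Rightarrow> bool" where
  "deg_compatible n W lt \<longleftrightarrow>
     (\<forall>s\<in>pprods n. \<forall>t\<in>pprods n. lex_less (wdeg W s) (wdeg W t) \<longrightarrow> lt s t)"

definition a0_DegRev_type :: "nat \<Rightarrow> int mat \<Rightarrow> (pprod \<Rightarrow> pprod \<Rightarrow> bool) \<Rightarrow> bool" where
  "a0_DegRev_type n W lt \<longleftrightarrow>
     deg_compatible n W lt \<and>
     (\<forall>s\<in>pprods n. \<forall>t\<in>pprods n.
        wdeg W t = wdeg W s \<and> Poly_Mapping.lookup t 0 < Poly_Mapping.lookup s 0 \<longrightarrow> lt s t)"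

definition lead_term :: "(pprod \<Rightarrow> pprod \<Rightarrow> bool) \<Rightarrow> ('k::zero) mpoly \<Rightarrow> pprod" where
  "lead_term lt f =
     (THE t. t \<in> Poly_Mapping.keys f \<and> (\<forall>s\<in>Poly_Mapping.keys f. s \<noteq> t \<longrightarrow> lt s t))"


subsection \<open>SAGBI bases and saturation\<close>

definition sagbi_basis ::
  "(pprod \<Rightarrow> pprod \<Rightarrow> bool) \<Rightarrow> ('k::field) mpoly set \<Rightarrow> 'k mpoly set \<Rightarrow> bool" where
  "sagbi_basis lt A G \<longleftrightarrow>
     G \<subseteq> A - {0} \<and>
     alg_gen (scalar :: 'k \<Rightarrow> 'k mpoly) ((\<lambda>f. pp_poly (lead_term lt f)) ` (A - {0})) =
     alg_gen scalar ((\<lambda>g. pp_poly (lead_term lt g)) ` G)"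

text \<open>The polynomial \<open>f : a\<^sub>0\<^sup>\<infinity>\<close>, meaningful for \<open>f \<noteq> 0\<close>.\<close>

definition poly_sat_a0 :: "('k::field) mpoly \<Rightarrow> 'k mpoly" where
  "poly_sat_a0 f = (THE h. f = indet 0 ^ (GREATEST i. indet 0 ^ i dvd f) * h)"

text \<open>
  \<open>S[a\<^sub>0, a\<^sub>0\<^sup>-\<^sup>1]\<close> is formed inside the field of fractions, into which \<open>P\<close> is embedded by
  \<^const>\<open>to_fract\<close>.
\<close>

definition laurent_a0 :: "('k::field) mpoly set \<Rightarrow> 'k mpoly fract set" where
  "laurent_a0 S =
     alg_gen (\<lambda>c. to_fract (scalar c))
       (to_fract ` S \<union> {to_fract (indet 0), inverse (to_fract (indet 0))})"

definition Sat_a0 :: "nat \<Rightarrow> ('k::field) mpoly set \<Rightarrow> 'k mpoly set" where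
  "Sat_a0 n S = {f \<in> polys n. to_fract f \<in> laurent_a0 S}"

end

theory Submission
  imports Defs
begin

text \<open>
  If \<open>f \<in> Sat(S)\<close> is non-zero, then \<open>a\<^sub>0\<^sup>i f \<in> S\<close> for some \<open>i\<close>, so \<open>a\<^sub>0\<^sup>i LT(f) = LT(a\<^sub>0\<^sup>i f)\<close> is a power
  product in the algebra generated by the \<open>LT(g)\<close>, \<open>g \<in> SB\<close>. That algebra is spanned by the
  products of its generators, hence \<open>a\<^sub>0\<^sup>i LT(f) = LT(g\<^sub>1) \<cdots> LT(g\<^sub>r)\<close> for some \<open>g\<^sub>k \<in> SB\<close>
  (lemma \<open>pp_poly_in_alg_gen_iff\<close>).

  The ordering being of \<open>a\<^sub>0\<close>-DegRev type, the leading term of a homogeneous \<open>g\<close> has the smallest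
  exponent of \<open>a\<^sub>0\<close> among the power products of \<open>g\<close>. Since some power product of \<open>g : a\<^sub>0\<^sup>\<infinity>\<close> is free
  of \<open>a\<^sub>0\<close>, this means \<open>LT(g) = a\<^sub>0\<^sup>e LT(g : a\<^sub>0\<^sup>\<infinity>)\<close> with \<open>LT(g : a\<^sub>0\<^sup>\<infinity>)\<close> free of \<open>a\<^sub>0\<close>
  (lemma \<open>lead_term_homogeneous_a0_free\<close>). Comparing the exponents of \<open>a\<^sub>0\<close>, the factor \<open>a\<^sub>0\<^sup>i\<close> can be
  cancelled: \<open>LT(f)\<close> is a power of \<open>a\<^sub>0\<close> times the product of the \<open>LT(g\<^sub>k : a\<^sub>0\<^sup>\<infinity>)\<close>.
\<close>


section \<open>Subalgebras generated by power products\<close>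

lemma subalgebra_of_alg_gen: "subalgebra_of \<iota> (alg_gen \<iota> G)"
  unfolding alg_gen_def
  by (rule hull_in) (fastforce simp: subalgebra_of_def)

lemma alg_gen_inc: "x \<in> G \<Longrightarrow> x \<in> alg_gen \<iota> G"
  unfolding alg_gen_def by (rule hull_inc)

lemma alg_gen_mult: "x \<in> alg_gen \<iota> G \<Longrightarrow> y \<in> alg_gen \<iota> G \<Longrightarrow> x * y \<in> alg_gen \<iota> G"
  using subalgebra_of_alg_gen unfolding subalgebra_of_def by blast

lemma alg_gen_embedding: "\<iota> c \<in> alg_gen \<iota> G"
  using subalgebra_of_alg_gen unfolding subalgebra_of_def by blast

lemma alg_gen_power:
  assumes "\<iota> 1 = 1" and "x \<in> alg_gen \<iota> G"
  shows "x ^ i \<in> alg_gen \<iota> G"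
  by (induction i) (use assms alg_gen_embedding[of \<iota> 1 G] in \<open>auto intro: alg_gen_mult\<close>)

lemma alg_gen_mono: "G \<subseteq> H \<Longrightarrow> alg_gen \<iota> G \<subseteq> alg_gen \<iota> H"
  unfolding alg_gen_def by (rule hull_mono)

lemma alg_gen_minimal: "G \<subseteq> A \<Longrightarrow> subalgebra_of \<iota> A \<Longrightarrow> alg_gen \<iota> G \<subseteq> A"
  unfolding alg_gen_def by (rule hull_minimal)

text \<open>The monoid of power products generated by \<open>T\<close>, in additive notation.\<close>

inductive_set pp_monoid :: "pprod set \<Rightarrow> pprod set" for T where
  zero: "0 \<in> pp_monoid T"
| step: "t \<in> T \<Longrightarrow> u \<in> pp_monoid T \<Longrightarrow> t + u \<in> pp_monoid T"

lemma pp_monoid_add: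
  assumes "u \<in> pp_monoid T" and "v \<in> pp_monoid T"
  shows "u + v \<in> pp_monoid T"
  using assms(1) by induction (use assms(2) in \<open>auto intro: pp_monoid.step simp: add.assoc\<close>)

lemma pp_monoid_inc: "t \<in> T \<Longrightarrow> t \<in> pp_monoid T"
  using pp_monoid.step[OF _ pp_monoid.zero] by fastforce

lemma pp_monoid_single:
  assumes "Poly_Mapping.single j 1 \<in> T"
  shows "Poly_Mapping.single j c \<in> pp_monoid T"
proof (induction c)
  case 0
  show ?case by (simp add: pp_monoid.zero)
next
  case (Suc c)
  have "Poly_Mapping.single j (Suc c) = Poly_Mapping.single j 1 + Poly_Mapping.single j c"
    by (simp flip: single_add)
  then show ?case using Suc assms by (simp add: pp_monoid.step)
qed

lemma scalar_1: "scalar 1 = 1"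
  by (simp add: scalar_def)

lemma pp_poly_0: "pp_poly 0 = 1"
  by (simp add: pp_poly_def)

lemma pp_poly_add: "pp_poly (s + t) = pp_poly s * pp_poly t"
  by (simp add: pp_poly_def mult_single)

lemma pp_poly_in_alg_gen_iff:
  "pp_poly t \<in> alg_gen (scalar :: 'k::field \<Rightarrow> _) (pp_poly ` T) \<longleftrightarrow> t \<in> pp_monoid T"
proof
  let ?A = "{f :: 'k mpoly. Poly_Mapping.keys f \<subseteq> pp_monoid T}"
  have "subalgebra_of scalar ?A"
    unfolding subalgebra_of_def
  proof (intro conjI ballI)
    show "range scalar \<subseteq> ?A"
      by (auto simp: scalar_def pp_monoid.zero split: if_splits)
    fix f g :: "'k mpoly"
    assume "f \<in> ?A" "g \<in> ?A"
    then have fg: "Poly_Mapping.keys f \<subseteq> pp_monoid T" "Poly_Mapping.keys g \<subseteq> pp_monoid T"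
      by auto
    then show "f + g \<in> ?A"
      using keys_add[of f g] by blast
    have "{a + b | a b. a \<in> Poly_Mapping.keys f \<and> b \<in> Poly_Mapping.keys g} \<subseteq> pp_monoid T"
      using fg pp_monoid_add by blast
    then show "f * g \<in> ?A"
      using keys_mult[of f g] by blast
  qed
  moreover have "pp_poly ` T \<subseteq> ?A"
    by (auto simp: pp_poly_def intro: pp_monoid_inc)
  moreover assume "pp_poly t \<in> alg_gen (scalar :: 'k \<Rightarrow> _) (pp_poly ` T)"
  ultimately have "(pp_poly t :: 'k mpoly) \<in> ?A"
    using alg_gen_minimal by blast
  then show "t \<in> pp_monoid T"
    by (simp add: pp_poly_def)
next
  assume "t \<in> pp_monoid T"
  then show "pp_poly t \<in> alg_gen (scalar :: 'k \<Rightarrow> _) (pp_poly ` T)"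
  proof induction
    case zero
    show ?case
      using alg_gen_embedding[of scalar 1] by (simp add: pp_poly_0 scalar_1)
  next
    case (step t u)
    then show ?case by (auto simp: pp_poly_add intro: alg_gen_mult alg_gen_inc)
  qed
qed


section \<open>Multiplication by a power of an indeterminate\<close>

lemma lookup_pp_poly_times:
  "Poly_Mapping.lookup (pp_poly t * f) (t + s) = Poly_Mapping.lookup f s"
proof -
  have "Poly_Mapping.lookup (pp_poly t * f) (t + s) =
      Sum_any (\<lambda>l. Sum_any (\<lambda>q. Poly_Mapping.lookup f q when t + s = l + q) when l = t)"
    unfolding lookup_mult pp_poly_def lookup_single
    by (rule Sum_any.cong) (simp add: when_def)
  also have "\<dots> = Sum_any (\<lambda>q. Poly_Mapping.lookup f q when s = q)"
    by simp
  finally show ?thesis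
    by simp
qed

lemma keys_pp_poly_times: "Poly_Mapping.keys (pp_poly t * f) = (+) t ` Poly_Mapping.keys f"
proof
  show "Poly_Mapping.keys (pp_poly t * f) \<subseteq> (+) t ` Poly_Mapping.keys f"
    using keys_mult[of "pp_poly t" f] by (auto simp: pp_poly_def split: if_splits)
  show "(+) t ` Poly_Mapping.keys f \<subseteq> Poly_Mapping.keys (pp_poly t * f)"
    by (auto simp: in_keys_iff lookup_pp_poly_times)
qed

lemma indet_power: "indet j ^ i = pp_poly (Poly_Mapping.single j i)"
proof (induction i)
  case 0
  show ?case by (simp add: pp_poly_0)
next
  case (Suc i)
  have "Poly_Mapping.single j (Suc i) = Poly_Mapping.single j 1 + Poly_Mapping.single j i"
    by (simp flip: single_add)
  then show ?case using Suc by (simp only: pp_poly_add power_Suc indet_def)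
qed

lemma indet_nonzero: "indet j \<noteq> 0"
  by (simp add: indet_def pp_poly_def flip: keys_eq_empty)

lemma pprods_add_iff: "s + t \<in> pprods n \<longleftrightarrow> s \<in> pprods n \<and> t \<in> pprods n"
  by (auto simp: pprods_def in_keys_iff lookup_add subset_iff)

lemma single_in_pprods: "j \<le> n \<Longrightarrow> Poly_Mapping.single j i \<in> pprods n"
  by (simp add: pprods_def)

lemma indet_power_times_in_polys_iff:
  "j \<le> n \<Longrightarrow> indet j ^ i * f \<in> polys n \<longleftrightarrow> f \<in> polys n"
  by (auto simp: polys_def indet_power keys_pp_poly_times pprods_add_iff single_in_pprods)

lemma indet_dvd:
  assumes "\<And>t. t \<in> Poly_Mapping.keys f \<Longrightarrow> Poly_Mapping.lookup t j \<noteq> 0"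
  shows "indet j dvd f"
proof
  let ?e = "Poly_Mapping.single j (1::nat)"
  \<comment> \<open>The coefficient of \<open>s\<close> in the quotient is that of \<open>a\<^sub>j s\<close> in \<open>f\<close>.\<close>
  let ?h = "Poly_Mapping.map_key ((+) ?e) f"
  have lookup_h: "Poly_Mapping.lookup ?h s = Poly_Mapping.lookup f (?e + s)" for s
    by (simp add: map_key.rep_eq)
  show "f = indet j * ?h"
  proof (rule poly_mapping_eqI)
    fix k
    show "Poly_Mapping.lookup f k = Poly_Mapping.lookup (indet j * ?h) k"
    proof (cases "Poly_Mapping.lookup k j = 0")
      case True
      then have "k \<notin> Poly_Mapping.keys (indet j * ?h)"
        by (auto simp: indet_def keys_pp_poly_times lookup_add)
      moreover have "k \<notin> Poly_Mapping.keys f"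
        using True assms by blast
      ultimately show ?thesis
        by (simp add: in_keys_iff)
    next
      case False
      then have "k = ?e + (k - ?e)"
        by (intro poly_mapping_eqI) (auto simp: lookup_add lookup_minus lookup_single when_def)
      then show ?thesis
        by (metis indet_def lookup_pp_poly_times lookup_h)
    qed
  qed
qed

text \<open>Every non-zero \<open>f\<close> is \<open>a\<^sub>0\<^sup>e (f : a\<^sub>0\<^sup>\<infinity>)\<close>, and \<open>f : a\<^sub>0\<^sup>\<infinity>\<close> has a power product free of \<open>a\<^sub>0\<close>.\<close>

lemma poly_sat_a0:
  assumes "f \<noteq> 0"
  obtains e s where "f = indet 0 ^ e * poly_sat_a0 f"
    and "s \<in> Poly_Mapping.keys (poly_sat_a0 f)" and "Poly_Mapping.lookup s 0 = 0"
proof -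
  define e where "e = (GREATEST i. indet 0 ^ i dvd f)"
  obtain t where t: "t \<in> Poly_Mapping.keys f"
    using assms by (metis ex_in_conv keys_eq_empty)
  have bound: "i \<le> Poly_Mapping.lookup t 0" if "indet 0 ^ i dvd f" for i
    using that t by (auto simp: indet_power keys_pp_poly_times lookup_add dvd_def)
  have "indet 0 ^ e dvd f"
    unfolding e_def by (rule GreatestI_nat[where k = 0, OF _ bound]) simp_all
  then obtain h where h: "f = indet 0 ^ e * h" ..
  have sat: "poly_sat_a0 f = h"
    unfolding poly_sat_a0_def e_def[symmetric]
    by (rule the_equality) (use h indet_nonzero in auto)
  have "\<not> indet 0 dvd h"
  proof
    assume "indet 0 dvd h"
    then have "indet 0 ^ Suc e dvd f"
      unfolding h by (simp add: mult.commute mult_dvd_mono)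
    then have "Suc e \<le> e"
      unfolding e_def by (rule Greatest_le_nat[OF _ bound]) simp_all
    then show False by simp
  qed
  then obtain s where "s \<in> Poly_Mapping.keys h" "Poly_Mapping.lookup s 0 = 0"
    using indet_dvd by blast
  then show thesis
    using that[of e s] h unfolding sat by blast
qed


section \<open>Leading terms\<close>

lemma term_ordering_asym:
  assumes lt: "term_ordering n lt" and st: "s \<in> pprods n" "t \<in> pprods n" "lt s t"
  shows "\<not> lt t s"
proof
  assume "lt t s"
  have "irreflp_on (pprods n) lt" "transp_on (pprods n) lt"
    using lt by (simp_all add: term_ordering_def)
  then show False
    using st \<open>lt t s\<close> irreflp_onD transp_onD[of "pprods n" lt s t s] by metis
qed

lemma lead_term_eqI:
  assumes lt: "term_ordering n lt" and f: "f \<in> polys n"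
    and t: "t \<in> Poly_Mapping.keys f" "\<And>s. s \<in> Poly_Mapping.keys f \<Longrightarrow> s \<noteq> t \<Longrightarrow> lt s t"
  shows "lead_term lt f = t"
  unfolding lead_term_def
proof (rule the_equality)
  fix u
  assume u: "u \<in> Poly_Mapping.keys f \<and> (\<forall>s\<in>Poly_Mapping.keys f. s \<noteq> u \<longrightarrow> lt s u)"
  show "u = t"
  proof (rule ccontr)
    assume "u \<noteq> t"
    then have "lt u t" "lt t u"
      using u t by auto
    moreover have "u \<in> pprods n" "t \<in> pprods n"
      using u t f by (auto simp: polys_def)
    ultimately show False
      using term_ordering_asym[OF lt] by blast
  qed
qed (use t in auto)

lemma lead_term:
  assumes lt: "term_ordering n lt" and f: "f \<in> polys n" "f \<noteq> 0"
  shows lead_term_in_keys: "lead_term lt f \<in> Poly_Mapping.keys f"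
    and lead_term_max: "s \<in> Poly_Mapping.keys f \<Longrightarrow> s \<noteq> lead_term lt f \<Longrightarrow> lt s (lead_term lt f)"
proof -
  have sub: "Poly_Mapping.keys f \<subseteq> pprods n"
    using f by (simp add: polys_def)
  have "\<exists>t\<in>Poly_Mapping.keys f. \<forall>s\<in>Poly_Mapping.keys f. s \<noteq> t \<longrightarrow> lt s t"
  proof (rule Finite_Set.bex_greatest_element)
    show "transp_on (Poly_Mapping.keys f) lt"
      by (rule transp_on_subset[OF _ sub]) (use lt in \<open>simp add: term_ordering_def\<close>)
    show "totalp_on (Poly_Mapping.keys f) lt"
      by (rule totalp_on_subset[OF _ sub]) (use lt in \<open>simp add: term_ordering_def\<close>)
  qed (use f in simp_all)
  then obtain t where t: "t \<in> Poly_Mapping.keys f"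
    "\<And>s. s \<in> Poly_Mapping.keys f \<Longrightarrow> s \<noteq> t \<Longrightarrow> lt s t"
    by blast
  then have "lead_term lt f = t"
    using lead_term_eqI[OF lt f(1)] by blast
  then show "lead_term lt f \<in> Poly_Mapping.keys f"
    and "s \<in> Poly_Mapping.keys f \<Longrightarrow> s \<noteq> lead_term lt f \<Longrightarrow> lt s (lead_term lt f)"
    using t by auto
qed

lemma lead_term_indet_power_times:
  assumes lt: "term_ordering n lt" and f: "f \<in> polys n" "f \<noteq> 0" and j: "j \<le> n"
  shows "lead_term lt (indet j ^ i * f) = Poly_Mapping.single j i + lead_term lt f"
proof (rule lead_term_eqI[OF lt])
  show "indet j ^ i * f \<in> polys n"
    using f j by (simp add: indet_power_times_in_polys_iff)
  show "Poly_Mapping.single j i + lead_term lt f \<in> Poly_Mapping.keys (indet j ^ i * f)"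
    using lead_term_in_keys[OF lt f] by (simp add: indet_power keys_pp_poly_times)
next
  fix s
  assume "s \<in> Poly_Mapping.keys (indet j ^ i * f)" "s \<noteq> Poly_Mapping.single j i + lead_term lt f"
  then obtain u where u: "u \<in> Poly_Mapping.keys f" "s = Poly_Mapping.single j i + u"
    "u \<noteq> lead_term lt f"
    by (auto simp: indet_power keys_pp_poly_times)
  moreover have "u \<in> pprods n" "lead_term lt f \<in> pprods n"
    using u f lead_term_in_keys[OF lt f] by (auto simp: polys_def)
  ultimately show "lt s (Poly_Mapping.single j i + lead_term lt f)"
    using lt lead_term_max[OF lt f] single_in_pprods[OF j]
    by (simp add: term_ordering_def add.commute[of "Poly_Mapping.single j i"])
qed

lemma lead_term_indet:
  assumes "term_ordering n lt" and "j \<le> n"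
  shows "lead_term lt (indet j) = Poly_Mapping.single j 1"
  by (rule lead_term_eqI[OF assms(1)])
    (use assms(2) in \<open>auto simp: polys_def indet_def pp_poly_def single_in_pprods\<close>)

lemma lead_term_homogeneous_a0_free:
  assumes lt: "term_ordering n lt" "a0_DegRev_type n W lt"
    and g: "g \<in> polys n" "g \<noteq> 0" "homogeneous W g"
  obtains e where "lead_term lt g = Poly_Mapping.single 0 e + lead_term lt (poly_sat_a0 g)"
    and "Poly_Mapping.lookup (lead_term lt (poly_sat_a0 g)) 0 = 0"
proof -
  let ?h = "poly_sat_a0 g"
  obtain e s where e: "g = indet 0 ^ e * ?h"
    and s: "s \<in> Poly_Mapping.keys ?h" "Poly_Mapping.lookup s 0 = 0"
    using poly_sat_a0[OF g(2)] by metis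
  have h: "?h \<in> polys n" "?h \<noteq> 0"
    using g e indet_power_times_in_polys_iff[of 0 n e ?h] by auto
  have LT: "lead_term lt g = Poly_Mapping.single 0 e + lead_term lt ?h"
    using lead_term_indet_power_times[OF lt(1) h, of 0 e] e by simp
  let ?s = "Poly_Mapping.single 0 e + s"
  have s': "?s \<in> Poly_Mapping.keys g"
    using s by (subst e) (simp add: indet_power keys_pp_poly_times)
  have LT': "lead_term lt g \<in> Poly_Mapping.keys g"
    by (rule lead_term_in_keys[OF lt(1) g(1,2)])
  have "Poly_Mapping.lookup (lead_term lt ?h) 0 = 0"
  proof (rule ccontr)
    assume "Poly_Mapping.lookup (lead_term lt ?h) 0 \<noteq> 0"
    then have less: "Poly_Mapping.lookup ?s 0 < Poly_Mapping.lookup (lead_term lt g) 0"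
      using s LT by (simp add: lookup_add)
    have pp: "?s \<in> pprods n" "lead_term lt g \<in> pprods n"
      using s' LT' g(1) by (auto simp: polys_def)
    moreover have "wdeg W ?s = wdeg W (lead_term lt g)"
      using g(3) s' LT' unfolding homogeneous_def by blast
    ultimately have "lt (lead_term lt g) ?s"
      using lt(2) less unfolding a0_DegRev_type_def by metis
    moreover have "lt ?s (lead_term lt g)"
      using lead_term_max[OF lt(1) g(1,2) s'] less by fastforce
    ultimately show False
      using term_ordering_asym[OF lt(1)] pp by blast
  qed
  with LT show thesis by (rule that)
qed


section \<open>Saturation\<close>

lemma to_fract_power: "to_fract (x ^ i) = to_fract x ^ i"
  by (induction i) auto

lemma mem_laurent_a0_iff:
  fixes S :: "('k::field) mpoly set"
  assumes S: "subalgebra_of scalar S" and a0: "indet 0 \<in> S"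
  shows "to_fract f \<in> laurent_a0 S \<longleftrightarrow> (\<exists>i. indet 0 ^ i * f \<in> S)"
proof
  let ?\<iota> = "\<lambda>c::'k. to_fract (scalar c)"
  let ?x = "to_fract (indet 0 :: 'k mpoly)"
  have add: "f + g \<in> S" and mult: "f * g \<in> S" if "f \<in> S" "g \<in> S" for f g
    using that S by (auto simp: subalgebra_of_def)
  have scal: "scalar c \<in> S" for c
    using S by (auto simp: subalgebra_of_def)
  have pow: "indet 0 ^ i \<in> S" for i
    by (induction i) (use scal[of 1] a0 in \<open>auto simp: scalar_1 intro: mult\<close>)
  have x: "?x \<noteq> 0"
    using indet_nonzero by simp
  \<comment> \<open>The fractions that some power of \<open>a\<^sub>0\<close> carries into \<open>S\<close> form a subalgebra.\<close>
  let ?A = "{z. \<exists>i. \<exists>f\<in>S. ?x ^ i * z = to_fract f}"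
  have "subalgebra_of ?\<iota> ?A"
    unfolding subalgebra_of_def
  proof (intro conjI ballI)
    show "range ?\<iota> \<subseteq> ?A"
      using scal by (auto intro!: exI[of _ 0])
  next
    fix y z
    assume "y \<in> ?A" "z \<in> ?A"
    then obtain i f j g where f: "f \<in> S" "?x ^ i * y = to_fract f"
      and g: "g \<in> S" "?x ^ j * z = to_fract g"
      by auto
    have "?x ^ (i + j) * (y + z) = ?x ^ j * (?x ^ i * y) + ?x ^ i * (?x ^ j * z)"
      by (simp add: power_add algebra_simps)
    also have "\<dots> = to_fract (indet 0 ^ j * f + indet 0 ^ i * g)"
      using f g by (simp add: to_fract_power)
    finally show "y + z \<in> ?A"
      using f(1) g(1) pow add mult by blast
    have "?x ^ (i + j) * (y * z) = (?x ^ i * y) * (?x ^ j * z)"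
      by (simp add: power_add algebra_simps)
    also have "\<dots> = to_fract (f * g)"
      using f g by simp
    finally show "y * z \<in> ?A"
      using f(1) g(1) mult by blast
  qed
  moreover have "to_fract ` S \<union> {?x, inverse ?x} \<subseteq> ?A"
  proof -
    have "to_fract ` S \<subseteq> ?A"
      by (auto intro!: exI[of _ 0])
    moreover have "?x \<in> ?A"
      using a0 by (auto intro!: exI[of _ 0])
    moreover have "inverse ?x \<in> ?A"
      using x scal[of 1] by (auto intro!: exI[of _ 1] bexI[of _ 1] simp: scalar_1)
    ultimately show ?thesis by blast
  qed
  moreover assume "to_fract f \<in> laurent_a0 S"
  ultimately have "to_fract f \<in> ?A"
    unfolding laurent_a0_def using alg_gen_minimal by blast
  then obtain i h where h: "h \<in> S" "to_fract (indet 0 ^ i * f) = to_fract h"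
    by (auto simp: to_fract_power)
  then show "\<exists>i. indet 0 ^ i * f \<in> S"
    by (metis to_fract_eq_iff)
next
  let ?x = "to_fract (indet 0 :: 'k mpoly)"
  assume "\<exists>i. indet 0 ^ i * f \<in> S"
  then obtain i where i: "indet 0 ^ i * f \<in> S" ..
  have x: "?x \<noteq> 0"
    using indet_nonzero by simp
  have "to_fract f = inverse ?x ^ i * to_fract (indet 0 ^ i * f)"
    using x by (simp add: power_inverse to_fract_power)
  also have "\<dots> \<in> laurent_a0 S"
    unfolding laurent_a0_def
    by (intro alg_gen_mult alg_gen_power alg_gen_inc) (use i in \<open>auto simp: scalar_1 simp del: to_fract_mult\<close>)
  finally show "to_fract f \<in> laurent_a0 S" .
qed

text \<open>
  Here \<open>T'\<close> contains \<open>a\<^sub>j\<close> and, for each element of \<open>T\<close>, its part free of \<open>a\<^sub>j\<close>. Any power of \<open>a\<^sub>j\<close>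
  that divides an element of the monoid of \<open>T\<close> can then be cancelled inside the monoid of \<open>T'\<close>, as the
  complementary factor is a power of \<open>a\<^sub>j\<close> times a product of elements of \<open>T'\<close> free of \<open>a\<^sub>j\<close>.
\<close>

lemma pp_monoid_cancel_single:
  assumes e: "Poly_Mapping.single j 1 \<in> T'"
    and T: "\<And>t. t \<in> T \<Longrightarrow>
      \<exists>c. \<exists>v\<in>T'. t = Poly_Mapping.single j c + v \<and> Poly_Mapping.lookup v j = 0"
    and t: "Poly_Mapping.single j i + t \<in> pp_monoid T"
  shows "t \<in> pp_monoid T'"
proof -
  have "\<exists>c. \<exists>v\<in>pp_monoid T'. u = Poly_Mapping.single j c + v \<and> Poly_Mapping.lookup v j = 0"
    if "u \<in> pp_monoid T" for u
    using that
  proof induction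
    case zero
    show ?case
      by (auto intro!: exI[of _ 0] bexI[of _ 0] pp_monoid.zero)
  next
    case (step t u)
    then obtain c v d w where "t = Poly_Mapping.single j c + v" "v \<in> T'"
      "Poly_Mapping.lookup v j = 0" "u = Poly_Mapping.single j d + w" "w \<in> pp_monoid T'"
      "Poly_Mapping.lookup w j = 0"
      using T by metis
    then show ?case
      by (intro exI[of _ "c + d"] bexI[of _ "v + w"])
        (auto simp: single_add lookup_add add_ac intro: pp_monoid.step)
  qed
  then obtain c v where v: "Poly_Mapping.single j i + t = Poly_Mapping.single j c + v"
    "v \<in> pp_monoid T'" "Poly_Mapping.lookup v j = 0"
    using t by metis
  have "i + Poly_Mapping.lookup t j = c"
    using arg_cong[OF v(1), of "\<lambda>u. Poly_Mapping.lookup u j"] v(3) by (simp add: lookup_add)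
  then have "Poly_Mapping.single j i + t =
      Poly_Mapping.single j i + (Poly_Mapping.single j (Poly_Mapping.lookup t j) + v)"
    using v(1) by (auto simp: single_add add_ac)
  then have "t = Poly_Mapping.single j (Poly_Mapping.lookup t j) + v"
    by simp
  then show ?thesis
    using pp_monoid_add[OF pp_monoid_single[OF e] v(2)] by metis
qed

theorem theorem7p2:
  fixes n m :: nat
    and W :: "int mat"
    and lt :: "pprod \<Rightarrow> pprod \<Rightarrow> bool"
    and S SB :: "('k::field) mpoly set"
  assumes W: "W \<in> carrier_mat m (n + 1)" "positive_matrix W"
    and lt: "term_ordering n lt" "a0_DegRev_type n W lt"
    and S: "fin_gen_subalgebra n S" "graded_subalgebra n W S"
    and a0: "indet 0 \<in> S"
    and SB: "sagbi_basis lt S SB"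
    and SB_homogeneous: "\<And>g. g \<in> SB \<Longrightarrow> homogeneous W g"
  shows "sagbi_basis lt (Sat_a0 n S) ({indet 0} \<union> {poly_sat_a0 g | g. g \<in> SB})"
proof -
  let ?G = "{indet 0} \<union> {poly_sat_a0 g | g. g \<in> SB}"
  let ?T = "lead_term lt ` SB" and ?T' = "lead_term lt ` ?G"
  have S': "S \<subseteq> polys n" "subalgebra_of scalar S"
    using S(1) by (auto simp: fin_gen_subalgebra_def poly_subalgebra_def)
  have SB': "g \<in> S" "g \<in> polys n" "g \<noteq> 0" if "g \<in> SB" for g
    using SB S' that by (auto simp: sagbi_basis_def)
  have Sat: "f \<in> Sat_a0 n S \<longleftrightarrow> f \<in> polys n \<and> (\<exists>i. indet 0 ^ i * f \<in> S)" for f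
    by (simp add: Sat_a0_def mem_laurent_a0_iff[OF S'(2) a0])

  have "indet 0 \<in> Sat_a0 n S"
    using a0 S'(1) by (auto simp: Sat intro!: exI[of _ 0])
  moreover have "poly_sat_a0 g \<in> Sat_a0 n S - {0}" if g: "g \<in> SB" for g
  proof -
    obtain e where e: "g = indet 0 ^ e * poly_sat_a0 g"
      using poly_sat_a0[OF SB'(3)[OF g]] by metis
    then have "poly_sat_a0 g \<in> polys n"
      using SB'(2)[OF g] indet_power_times_in_polys_iff[of 0 n e "poly_sat_a0 g"] by simp
    moreover have "poly_sat_a0 g \<noteq> 0"
      using e SB'(3)[OF g] by auto
    moreover have "indet 0 ^ e * poly_sat_a0 g \<in> S"
      using e SB'(1)[OF g] by simp
    ultimately show ?thesis
      unfolding Diff_iff Sat by blast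
  qed
  ultimately have G: "?G \<subseteq> Sat_a0 n S - {0}"
    using indet_nonzero by auto

  have T': "\<exists>c. \<exists>v\<in>?T'. t = Poly_Mapping.single 0 c + v \<and> Poly_Mapping.lookup v 0 = 0"
    if t: "t \<in> ?T" for t
  proof -
    obtain g where g: "g \<in> SB" "t = lead_term lt g"
      using t by auto
    obtain e where "lead_term lt g = Poly_Mapping.single 0 e + lead_term lt (poly_sat_a0 g)"
      "Poly_Mapping.lookup (lead_term lt (poly_sat_a0 g)) 0 = 0"
      using lead_term_homogeneous_a0_free[OF lt SB'(2,3)[OF g(1)] SB_homogeneous[OF g(1)]] .
    then show ?thesis
      using g by blast
  qed
  have e: "Poly_Mapping.single 0 1 \<in> ?T'"
    using lead_term_indet[OF lt(1), of 0] by (metis (lifting) UnI1 image_eqI singletonI zero_le)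

  have "lead_term lt f \<in> pp_monoid ?T'" if f: "f \<in> Sat_a0 n S - {0}" for f
  proof -
    obtain i where i: "f \<in> polys n" "f \<noteq> 0" "indet 0 ^ i * f \<in> S"
      using f by (auto simp: Sat)
    have "indet 0 ^ i * f \<in> S - {0}"
      using i indet_nonzero by auto
    then have "pp_poly (lead_term lt (indet 0 ^ i * f)) \<in>
        alg_gen (scalar :: 'k \<Rightarrow> _) ((\<lambda>f. pp_poly (lead_term lt f)) ` (S - {0}))"
      by (intro alg_gen_inc) auto
    also have "\<dots> = alg_gen scalar (pp_poly ` ?T)"
      using SB by (simp add: sagbi_basis_def image_image)
    finally have "Poly_Mapping.single 0 i + lead_term lt f \<in> pp_monoid ?T"
      using i by (simp add: pp_poly_in_alg_gen_iff lead_term_indet_power_times[OF lt(1)])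
    then show ?thesis
      using pp_monoid_cancel_single[OF e T'] by blast
  qed
  then have "(\<lambda>f. pp_poly (lead_term lt f)) ` (Sat_a0 n S - {0}) \<subseteq>
      alg_gen (scalar :: 'k \<Rightarrow> _) (pp_poly ` ?T')"
    unfolding image_subset_iff pp_poly_in_alg_gen_iff by blast
  then have "alg_gen (scalar :: 'k \<Rightarrow> _) ((\<lambda>f. pp_poly (lead_term lt f)) ` (Sat_a0 n S - {0})) \<subseteq>
      alg_gen scalar ((\<lambda>g. pp_poly (lead_term lt g)) ` ?G)"
    unfolding image_image by (rule alg_gen_minimal[OF _ subalgebra_of_alg_gen])
  moreover have "alg_gen (scalar :: 'k \<Rightarrow> _) ((\<lambda>g. pp_poly (lead_term lt g)) ` ?G) \<subseteq>
      alg_gen scalar ((\<lambda>f. pp_poly (lead_term lt f)) ` (Sat_a0 n S - {0}))"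
    by (intro alg_gen_mono image_mono G)
  ultimately show ?thesis
    using G unfolding sagbi_basis_def by blast
qed

end
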